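(* Let $q$ be a formal variable and let $X_k$ ($k\in\mathbb{Z}$) be the cluster variables of the quantum cluster algebra $\mathcal{A}_q(2,2)$. For every $n\ge 0$ one has $$X_{-n}=X^{(n+2,-n-1)}+\sum_{p+r\le n}{n-r \brack p}_q{n+1-p\brack r}_q X^{(2r-n,\,2p-n-1)},$$ $$X_{n+3}=X^{(-n-1,n+2)}+\sum_{p+r\le n}{n-r \brack p}_q{n+1-p\brack r}_q X^{(2p-n-1,\,2r-n)},$$ where both sums are over integers $p,r\ge 0$ with $p+r\le n$.
   Context: Let $\mathcal{T}_q=\mathbb{Z}[q^{\pm 1/2}]\langle X_1^{\pm1},X_2^{\pm1}: X_1X_2=qX_2X_1\rangle$ be the 2-dimensional quantum torus and $\mathcal{F}_q$ its skew field of fractions. For $b,c\in\mathbb{Z}_{>0}$, $\mathcal{A}_q(b,c)$ is the $\mathbb{Z}[q^{\pm1/2}]$-subalgebra of $\mathcal{F}_q$ generated by the cluster variables $X_k$, $k\in\mathbb{Z}$, defined recursively from $X_1,X_2$ by $X_{m-1}X_{m+1}=q^{b/2}X_m^b+1$ if $m$ is odd and $X_{m-1}X_{m+1}=q^{c/2}X_m^c+1$ if $m$ is even. (So for $b=c=2$: $X_{m-1}X_{m+1}=qX_m^2+1$ for all $m\in\mathbb{Z}$.) For $a_1,a_2\in\mathbb{Z}$, $X^{(a_1,a_2)}:=q^{-\frac12 a_1a_2}X_1^{a_1}X_2^{a_2}$. The symmetrized quantum binomial coefficient is $${n \brack r}_q:=\frac{(q^n-q^{-n})(q^{n-1}-q^{-n+1})\cdots(q^{n-r+1}-q^{-n+r-1})}{(q^r-q^{-r})\cdots(q-q^{-1})},$$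 equal to $1$ for $r=0$. *)

theory Defs
  imports "HOL-Library.Poly_Mapping"
begin

text \<open>
  \<open>QMono k a b\<close> stands for the monomial \<open>q\<^bsup>k/2\<^esup> X\<^sub>1\<^sup>a X\<^sub>2\<^sup>b\<close>. These monomials form a group under
  multiplication, written additively below because the convolution product of
  \<open>poly_mapping\<close> expects an additive exponent monoid (which need not be commutative). Moving
  \<open>X\<^sub>2\<^sup>b\<close> past \<open>X\<^sub>1\<^sup>a\<^sup>'\<close> with \<open>X\<^sub>1 X\<^sub>2 = q X\<^sub>2 X\<^sub>1\<close> costs the factor \<open>q\<^bsup>-b a'\<^esup>\<close>.
\<close>

datatype qmono = QMono int int int

instantiation qmono :: group_add
begin

definition zero_qmono :: qmono where
  "0 = QMono 0 0 0"

fun plus_qmono :: "qmono \<Rightarrow> qmono \<Rightarrow> qmono" where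
  "QMono k a b + QMono k' a' b' = QMono (k + k' - 2 * b * a') (a + a') (b + b')"

fun uminus_qmono :: "qmono \<Rightarrow> qmono" where
  "- QMono k a b = QMono (- k - 2 * a * b) (- a) (- b)"

definition minus_qmono :: "qmono \<Rightarrow> qmono \<Rightarrow> qmono" where
  "x - y = x + (- y)" for x y :: qmono

instance
proof
  fix x y z :: qmono
  show "x + y + z = x + (y + z)"
    by (cases x; cases y; cases z) (simp add: algebra_simps)
  show "0 + x = x" by (cases x) (simp add: zero_qmono_def)
  show "x + 0 = x" by (cases x) (simp add: zero_qmono_def)
  show "- x + x = 0" by (cases x) (simp add: zero_qmono_def)
  show "x + - y = x - y" by (simp add: minus_qmono_def)
qed

end

text \<open>
  The quantum torus \<open>\<int>[q\<^bsup>\<plusminus>1/2\<^esup>]\<langle>X\<^sub>1\<^bsup>\<plusminus>1\<^esup>, X\<^sub>2\<^bsup>\<plusminus>1\<^esup> : X\<^sub>1 X\<^sub>2 = q X\<^sub>2 X\<^sub>1\<rangle>\<close>: all its defining relations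
  are between monomials, so it is the integral group ring of the group above. The coefficient
  ring \<open>\<int>[q\<^bsup>\<plusminus>1/2\<^esup>]\<close> is the span of the \<open>QMono k 0 0\<close>; it is central.
\<close>

type_synonym qtorus = "qmono \<Rightarrow>\<^sub>0 int"

definition qhalf :: qtorus where  \<comment> \<open>\<open>q\<^bsup>1/2\<^esup>\<close>\<close>
  "qhalf = Poly_Mapping.single (QMono 1 0 0) 1"

definition qvar :: qtorus where  \<comment> \<open>\<open>q\<close>\<close>
  "qvar = qhalf ^ 2"

definition torus_X1 :: qtorus where
  "torus_X1 = Poly_Mapping.single (QMono 0 1 0) 1"

definition torus_X2 :: qtorus where
  "torus_X2 = Poly_Mapping.single (QMono 0 0 1) 1"

lemma torus_relation: "torus_X1 * torus_X2 = qvar * torus_X2 * torus_X1"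
  by (simp add: torus_X1_def torus_X2_def qvar_def qhalf_def power2_eq_square mult_single)

lemma single_eq_monomial:
  "Poly_Mapping.single (QMono k 0 0) 1 * Poly_Mapping.single (QMono 0 a 0) 1
     * Poly_Mapping.single (QMono 0 0 b) 1 = (Poly_Mapping.single (QMono k a b) 1 :: qtorus)"
  by (simp add: mult_single)

text \<open>
  \<open>skew_fraction_field \<iota>\<close>: the division ring \<open>'f\<close> is the skew field of fractions of \<open>'a\<close>, with
  \<open>\<iota>\<close> the canonical embedding. For an Ore domain such as the quantum torus it exists and is
  unique up to a unique isomorphism over \<open>'a\<close>.
\<close>

definition skew_fraction_field :: "('a::ring_1 \<Rightarrow> 'f::division_ring) \<Rightarrow> bool" where
  "skew_fraction_field \<iota> \<longleftrightarrow>
     inj \<iota> \<and> \<iota> 1 = 1 \<and>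
     (\<forall>x y. \<iota> (x + y) = \<iota> x + \<iota> y) \<and> (\<forall>x y. \<iota> (x * y) = \<iota> x * \<iota> y) \<and>
     (\<forall>f. \<exists>a s. s \<noteq> 0 \<and> f = \<iota> a * inverse (\<iota> s))"

text \<open>
  The cluster variables of \<open>\<A>\<^sub>q(b,c)\<close>, obtained by solving the exchange relation
  \<open>X\<^bsub>m-1\<^esub> X\<^bsub>m+1\<^esub> = q\<^bsup>b/2\<^esup> X\<^sub>m\<^sup>b + 1\<close> (\<open>m\<close> odd), \<open>q\<^bsup>c/2\<^esup> X\<^sub>m\<^sup>c + 1\<close> (\<open>m\<close> even) for \<open>X\<^bsub>m+1\<^esub>\<close> when
  \<open>m \<ge> 2\<close> and for \<open>X\<^bsub>m-1\<^esub>\<close> when \<open>m \<le> 1\<close>. No division by zero occurs, and the exchange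
  relation holds for all \<open>m\<close>: see \<open>exchange_relation\<close> below.
\<close>

definition exch_exponent :: "nat \<Rightarrow> nat \<Rightarrow> int \<Rightarrow> nat" where
  "exch_exponent b c m = (if odd m then b else c)"

function cluster_var :: "(qtorus \<Rightarrow> 'f::division_ring) \<Rightarrow> nat \<Rightarrow> nat \<Rightarrow> int \<Rightarrow> 'f" where
  "cluster_var \<iota> b c k =
    (if k = 1 then \<iota> torus_X1
     else if k = 2 then \<iota> torus_X2
     else if k > 2 then
       (let m = k - 1; e = exch_exponent b c m in
         inverse (cluster_var \<iota> b c (m - 1)) * (\<iota> qhalf ^ e * cluster_var \<iota> b c m ^ e + 1))
     else
       (let m = k + 1; e = exch_exponent b c m in
         (\<iota> qhalf ^ e * cluster_var \<iota> b c m ^ e + 1) * inverse (cluster_var \<iota> b c (m + 1))))"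
  by pat_completeness auto
termination
  by (relation "Wellfounded.measure (\<lambda>(\<iota>, b, c, k). nat \<bar>2 * k - 3\<bar>)") auto

declare cluster_var.simps [simp del]

definition torus_monomial :: "(qtorus \<Rightarrow> 'f::division_ring) \<Rightarrow> int \<Rightarrow> int \<Rightarrow> 'f" where
  "torus_monomial \<iota> a1 a2 =
     \<iota> qhalf powi (- (a1 * a2)) * \<iota> torus_X1 powi a1 * \<iota> torus_X2 powi a2"

text \<open>
  \<open>prod_list\<close> because multiplication in \<open>'f\<close> is not commutative; for central \<open>Q\<close> the order of
  the factors is immaterial.
\<close>

definition sym_qbinomial :: "'f::division_ring \<Rightarrow> int \<Rightarrow> nat \<Rightarrow> 'f" where
  "sym_qbinomial Q n r =
     (\<Prod>i\<leftarrow>[0..<r]. Q powi (n - int i) - Q powi (- n + int i)) /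
     (\<Prod>i\<leftarrow>[0..<r]. Q powi (int r - int i) - Q powi (- int r + int i))"

lemma sym_qbinomial_0: "sym_qbinomial Q n 0 = 1"
  by (simp add: sym_qbinomial_def)


lemma commute_power:
  fixes Q y :: "'f::division_ring"
  assumes "Q * y = y * Q"
  shows "Q ^ e * y = y * Q ^ e"
  by (metis assms power_commuting_commutes)

lemma qcommute_power:
  fixes x y Q :: "'f::division_ring"
  assumes "x * y = Q * (y * x)" and "\<And>z. Q * z = z * Q"
  shows "x * y ^ e = Q ^ e * (y ^ e * x)" and "x ^ e * y = Q ^ e * (y * x ^ e)"
proof -
  have *: "Q ^ k * z = z * Q ^ k" for z k
    using assms(2) by (rule commute_power)
  show "x * y ^ e = Q ^ e * (y ^ e * x)"
  proof (induction e)
    case (Suc e)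
    have "x * y ^ Suc e = (x * y ^ e) * y" by (simp only: power_Suc2 mult.assoc)
    also have "\<dots> = Q ^ e * (y ^ e * (x * y))" by (simp add: Suc mult.assoc)
    also have "\<dots> = Q ^ e * (Q * (y ^ e * (y * x)))"
      by (simp only: assms(1) assms(2)[of "y ^ e * (y * x)"] mult.assoc
            assms(2)[of "y * x"])
    also have "\<dots> = Q ^ Suc e * (y ^ Suc e * x)"
      by (simp only: power_Suc2 mult.assoc)
    finally show ?case .
  qed simp
  show "x ^ e * y = Q ^ e * (y * x ^ e)"
  proof (induction e)
    case (Suc e)
    have "x ^ Suc e * y = x * (x ^ e * y)" by (simp add: mult.assoc)
    also have "\<dots> = (x * Q ^ e) * (y * x ^ e)" by (simp only: Suc mult.assoc)
    also have "\<dots> = Q ^ e * ((x * y) * x ^ e)" by (simp only: *[of e x, symmetric] mult.assoc)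
    also have "\<dots> = Q ^ Suc e * (y * x ^ Suc e)"
      by (simp only: assms(1) power_Suc2[of Q] power_Suc[of x] mult.assoc)
    finally show ?case .
  qed simp
qed

lemma exchange_nonzero:
  fixes x y h Q :: "'f::division_ring"
  assumes xy: "x * y = Q * (y * x)" and x: "x \<noteq> 0" and y: "y \<noteq> 0"
    and Qc: "\<And>z. Q * z = z * Q" and hc: "\<And>z. h * z = z * h" and Qe: "Q ^ e \<noteq> 1"
  shows "h ^ e * y ^ e + 1 \<noteq> 0" and "h ^ e * x ^ e + 1 \<noteq> 0"
proof -
  have H: "h ^ e * z = z * h ^ e" for z using hc by (rule commute_power)
  show "h ^ e * y ^ e + 1 \<noteq> 0"
  proof
    assume "h ^ e * y ^ e + 1 = 0"
    then have E: "h ^ e * y ^ e = - 1" by (simp add: eq_neg_iff_add_eq_0)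
    have "- x = x * (h ^ e * y ^ e)" by (simp add: E)
    also have "\<dots> = h ^ e * (Q ^ e * (y ^ e * x))"
      by (metis H qcommute_power(1)[OF xy Qc] mult.assoc)
    also have "\<dots> = Q ^ e * ((h ^ e * y ^ e) * x)"
      by (metis H mult.assoc)
    finally have "Q ^ e * x = 1 * x" by (simp add: E)
    then show False using x Qe by (metis mult_right_cancel)
  qed
  show "h ^ e * x ^ e + 1 \<noteq> 0"
  proof
    assume "h ^ e * x ^ e + 1 = 0"
    then have E: "h ^ e * x ^ e = - 1" by (simp add: eq_neg_iff_add_eq_0)
    have "- y = (h ^ e * x ^ e) * y" by (simp add: E)
    also have "\<dots> = h ^ e * (Q ^ e * (y * x ^ e))"
      by (metis qcommute_power(2)[OF xy Qc] mult.assoc)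
    also have "\<dots> = Q ^ e * (y * (h ^ e * x ^ e))"
      by (metis H mult.assoc)
    finally have "Q ^ e * y = 1 * y" by (simp add: E)
    then show False using y Qe by (metis mult_right_cancel)
  qed
qed

lemma exchange_step_up:
  fixes x y h Q :: "'f::division_ring"
  assumes xy: "x * y = Q * (y * x)" and x: "x \<noteq> 0"
    and Qc: "\<And>z. Q * z = z * Q" and hc: "\<And>z. h * z = z * h"
    and z: "z = inverse x * (h ^ e * y ^ e + 1)"
  shows "y * z = Q * (z * y)"
proof -
  have H: "h ^ e * u = u * h ^ e" for u using hc by (rule commute_power)
  let ?P = "h ^ e * y ^ e + 1"
  have "y * (h ^ e * y ^ e) = h ^ e * (y * y ^ e)"
    by (simp only: H[of y] flip: mult.assoc)
  then have P: "y * ?P = ?P * y"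
    by (simp add: distrib_left distrib_right mult.assoc power_commutes)
  have "x * (y * inverse x) = Q * y"
    using xy x by (metis mult.assoc right_inverse mult.right_neutral)
  then have "y * inverse x = inverse x * (Q * y)"
    using x by (metis mult.assoc left_inverse mult.left_neutral)
  then have "y * inverse x = Q * (inverse x * y)" by (metis Qc mult.assoc)
  then have "y * z = Q * (inverse x * (y * ?P))" by (simp add: z flip: mult.assoc)
  also have "\<dots> = Q * (z * y)" by (simp only: P z mult.assoc)
  finally show ?thesis .
qed

lemma exchange_step_down:
  fixes x y h Q :: "'f::division_ring"
  assumes xy: "x * y = Q * (y * x)" and y: "y \<noteq> 0"
    and Qc: "\<And>z. Q * z = z * Q" and hc: "\<And>z. h * z = z * h"
    and w: "w = (h ^ e * x ^ e + 1) * inverse y"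
  shows "w * x = Q * (x * w)"
proof -
  have H: "h ^ e * u = u * h ^ e" for u using hc by (rule commute_power)
  let ?P = "h ^ e * x ^ e + 1"
  have "x * (h ^ e * x ^ e) = h ^ e * (x * x ^ e)"
    by (simp only: H[of x] flip: mult.assoc)
  then have P: "x * ?P = ?P * x"
    by (simp add: distrib_left distrib_right mult.assoc power_commutes)
  have "inverse y * x = inverse y * (x * y) * inverse y"
    using y by (simp add: mult.assoc)
  also have "\<dots> = Q * (inverse y * y * x * inverse y)"
    by (metis xy Qc mult.assoc)
  finally have "inverse y * x = Q * (x * inverse y)" using y by simp
  then have "w * x = ?P * (Q * (x * inverse y))" by (simp add: w mult.assoc)
  also have "\<dots> = Q * ((?P * x) * inverse y)" by (metis Qc mult.assoc)
  also have "\<dots> = Q * (x * w)" by (simp only: w mult.assoc flip: P)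
  finally show ?thesis .
qed

context
  fixes \<iota> :: "qtorus \<Rightarrow> 'f::division_ring"
  assumes \<iota>: "skew_fraction_field \<iota>"
begin

lemma emb_add: "\<iota> (x + y) = \<iota> x + \<iota> y"
  and emb_mult: "\<iota> (x * y) = \<iota> x * \<iota> y"
  and emb_one: "\<iota> 1 = 1"
  and emb_inj: "inj \<iota>"
  using \<iota> by (auto simp: skew_fraction_field_def)

lemma emb_zero: "\<iota> 0 = 0"
  using emb_add[of 0 0] by simp

lemma emb_power: "\<iota> (x ^ k) = \<iota> x ^ k"
  by (induction k) (simp_all add: emb_one emb_mult)

lemma emb_eq_0_iff: "\<iota> x = 0 \<longleftrightarrow> x = 0"
  using emb_inj emb_zero by (metis injD)

lemma qhalf_commute_torus: "qhalf * x = x * qhalf"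
proof (rule frag_induction[of x UNIV])
  show "qhalf * Poly_Mapping.single k 1 = Poly_Mapping.single k 1 * qhalf" for k
    by (cases k) (simp add: qhalf_def mult_single add.commute)
qed (simp_all add: left_diff_distrib right_diff_distrib)

lemma qhalf_central: "\<iota> qhalf * f = f * \<iota> qhalf"
proof -
  obtain a s where s: "s \<noteq> 0" and f: "f = \<iota> a * inverse (\<iota> s)"
    using \<iota> unfolding skew_fraction_field_def by blast
  have "\<iota> qhalf * \<iota> s = \<iota> s * \<iota> qhalf"
    by (metis emb_mult qhalf_commute_torus)
  then have "\<iota> qhalf * inverse (\<iota> s) = inverse (\<iota> s) * \<iota> qhalf"
    by (metis mult_commute_imp_mult_inverse_commute)
  then show ?thesis unfolding f by (metis emb_mult mult.assoc qhalf_commute_torus)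
qed

lemma qvar_central: "\<iota> qvar * f = f * \<iota> qvar"
  unfolding qvar_def emb_power using qhalf_central by (rule commute_power)

lemma qhalf_power: "qhalf ^ k = Poly_Mapping.single (QMono (int k) 0 0) 1"
  by (induction k) (simp_all add: qhalf_def mult_single flip: zero_qmono_def)

lemma qvar_power_neq_1:
  assumes "k > 0" shows "\<iota> qvar ^ k \<noteq> 1"
proof
  assume "\<iota> qvar ^ k = 1"
  then have "\<iota> (qvar ^ k) = \<iota> 1" by (simp add: emb_power emb_one)
  then have "qvar ^ k = 1" using emb_inj by (metis injD)
  then have "qhalf ^ (2 * k) = 1" by (simp only: qvar_def power_mult)
  then have "Poly_Mapping.single (QMono (int (2 * k)) 0 0) 1 = (Poly_Mapping.single 0 1 :: qtorus)"
    by (simp only: qhalf_power single_one)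
  then have "QMono (int (2 * k)) 0 0 = 0" by (metis frag_of_eq)
  then show False using assms by (simp add: zero_qmono_def)
qed

context
  fixes b c :: nat
  assumes bc: "b > 0" "c > 0"
begin

lemma cluster_var_up:
  assumes "m \<ge> 2"
  shows "cluster_var \<iota> b c (m + 1) = inverse (cluster_var \<iota> b c (m - 1)) *
    (\<iota> qhalf ^ exch_exponent b c m * cluster_var \<iota> b c m ^ exch_exponent b c m + 1)"
  using assms by (subst cluster_var.simps) (simp add: Let_def)

lemma cluster_var_down:
  assumes "m \<le> 1"
  shows "cluster_var \<iota> b c (m - 1) =
    (\<iota> qhalf ^ exch_exponent b c m * cluster_var \<iota> b c m ^ exch_exponent b c m + 1)
      * inverse (cluster_var \<iota> b c (m + 1))"
  using assms by (subst cluster_var.simps) (simp add: Let_def)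

lemma exch_exponent_neq_1: "\<iota> qvar ^ exch_exponent b c m \<noteq> 1"
  using bc by (simp add: exch_exponent_def qvar_power_neq_1)

lemma cluster_vars_qcommute:
  "cluster_var \<iota> b c m \<noteq> 0 \<and> cluster_var \<iota> b c (m + 1) \<noteq> 0 \<and>
   cluster_var \<iota> b c m * cluster_var \<iota> b c (m + 1)
     = \<iota> qvar * (cluster_var \<iota> b c (m + 1) * cluster_var \<iota> b c m)"
proof (induction m rule: int_induct[where k = 1])
  case base
  have "\<iota> torus_X1 \<noteq> 0" "\<iota> torus_X2 \<noteq> 0"
    by (simp_all add: emb_eq_0_iff torus_X1_def torus_X2_def)
  then show ?case
    using torus_relation by (simp add: cluster_var.simps mult.assoc flip: emb_mult)
next
  case (step1 m)
  have z: "cluster_var \<iota> b c (m + 1 + 1) = inverse (cluster_var \<iota> b c m) *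
    (\<iota> qhalf ^ exch_exponent b c (m + 1) * cluster_var \<iota> b c (m + 1) ^ exch_exponent b c (m + 1) + 1)"
    using cluster_var_up[of "m + 1"] step1 by simp
  then show ?case
    using step1 exchange_step_up[OF _ _ qvar_central qhalf_central z]
      exchange_nonzero(1)[OF _ _ _ qvar_central qhalf_central exch_exponent_neq_1[of "m + 1"]]
    by auto
next
  case (step2 m)
  have z: "cluster_var \<iota> b c (m - 1) =
    (\<iota> qhalf ^ exch_exponent b c m * cluster_var \<iota> b c m ^ exch_exponent b c m + 1)
      * inverse (cluster_var \<iota> b c (m + 1))"
    using cluster_var_down[of m] step2 by simp
  then show ?case
    using step2 exchange_step_down[OF _ _ qvar_central qhalf_central z]
      exchange_nonzero(2)[OF _ _ _ qvar_central qhalf_central exch_exponent_neq_1[of m]]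
    by auto
qed

lemma cluster_var_nonzero: "cluster_var \<iota> b c m \<noteq> 0"
  using cluster_vars_qcommute by blast

theorem exchange_relation:
  "cluster_var \<iota> b c (m - 1) * cluster_var \<iota> b c (m + 1) =
     \<iota> qhalf ^ exch_exponent b c m * cluster_var \<iota> b c m ^ exch_exponent b c m + 1"
proof (cases "m \<ge> 2")
  case True
  then show ?thesis
    using cluster_var_up[OF True] cluster_var_nonzero[of "m - 1"] by (simp flip: mult.assoc)
next
  case False
  then show ?thesis
    using cluster_var_down[of m] cluster_var_nonzero[of "m + 1"] by (simp add: mult.assoc)
qed

end

end

end

theory Submission
  imports Defs
begin

text \<open>
  The exchange relations are quadratic, but for \<open>b = c = 2\<close> they linearize. Put \<open>h = q\<^bsup>1/2\<^esup>\<close> and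
  \<open>\<delta> = X\<^bsup>(1,-1)\<^esup> + X\<^bsup>(-1,1)\<^esup> + X\<^bsup>(-1,-1)\<^esup>\<close>. Then
  \<open>h \<delta> X\<^sub>m = q X\<^bsub>m-1\<^esub> + X\<^bsub>m+1\<^esub>\<close> for all integers \<open>m\<close> (\<open>cluster_linear_recurrence\<close>): the expression
  \<open>(q X\<^bsub>m-1\<^esub> + X\<^bsub>m+1\<^esub>) X\<^sub>m\<^bsup>-1\<^esup>\<close> does not depend on \<open>m\<close>, as a consequence of two consecutive exchange
  relations and \<open>X\<^sub>m X\<^bsub>m+1\<^esub> = q X\<^bsub>m+1\<^esub> X\<^sub>m\<close> (\<open>exchange_transports_recurrence\<close>), and its value can be read
  off at \<open>m = 1\<close>.

  It remains to see that the claimed expansions satisfy this linear recurrence. The isolated monomial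
  \<open>X\<^bsup>(-n-1,n+2)\<^esup>\<close> is the term \<open>p = 0\<close>, \<open>r = n + 1\<close> of the sum, because its coefficient is
  \<open>[-1 choose 0] [n+1 choose n+1] = 1\<close>, while the other terms with \<open>p + r = n + 1\<close> vanish. With
  \<open>m = n + 1\<close> the claim therefore reads
  \<open>X\<^bsub>m+2\<^esub> = \<Sum>\<^bsub>p+r\<le>m\<^esub> [m-1-r choose p] [m-p choose r] X\<^bsup>(2p-m,2r-m+1)\<^esup>\<close>, which also makes sense for
  \<open>m = 0\<close>, where it says \<open>X\<^sub>2 = X\<^bsup>(0,1)\<^esup>\<close>. The three monomials of \<open>\<delta>\<close> move the index \<open>(p, r)\<close> to
  \<open>(p+1, r)\<close>, \<open>(p, r+1)\<close> and \<open>(p, r)\<close>, so comparing coefficients leaves a relation between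
  products of two \<open>q\<close>-binomials (\<open>kronecker_coeff_rec\<close>). It is what one gets by applying one
  \<open>q\<close>-Pascal rule to each factor and multiplying out.

  The variables with indices \<open>\<le> 1\<close> need no second computation: running the recurrence downwards
  exchanges \<open>q\<close> with \<open>q\<^bsup>-1\<^esup>\<close>, which is compensated by exchanging the two coordinates of the exponent
  vectors, and symmetrized \<open>q\<close>-binomials do not change under \<open>q \<mapsto> q\<^bsup>-1\<^esup>\<close>. For this reason the
  expansion is studied in the locale \<open>quantum_torus_basis\<close>, which is instantiated twice.
\<close>

section \<open>Central elements\<close>

definition central :: "'a::monoid_mult \<Rightarrow> bool" where
  "central x \<longleftrightarrow> (\<forall>y. x * y = y * x)"

lemma centralD: "central x \<Longrightarrow> x * y = y * x"
  by (simp add: central_def)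

lemma central_left_commute: "central c \<Longrightarrow> x * (c * y) = c * (x * y)"
  by (metis centralD mult.assoc)

lemma central_1: "central 1"
  by (simp add: central_def)

lemma central_0: "central (0 :: 'a::semiring_1)"
  by (simp add: central_def)

lemma central_mult: "central x \<Longrightarrow> central y \<Longrightarrow> central (x * y)"
  by (metis central_def mult.assoc)

lemma central_diff: "central x \<Longrightarrow> central y \<Longrightarrow> central (x - y :: 'a::ring_1)"
  by (simp add: central_def left_diff_distrib right_diff_distrib)

lemma central_inverse: "central x \<Longrightarrow> central (inverse x :: 'a::division_ring)"
  by (metis central_def mult_commute_imp_mult_inverse_commute)

lemma central_power: "central x \<Longrightarrow> central (x ^ k)"
  by (induction k) (simp_all add: central_1 central_mult)

lemma central_power_int: "central x \<Longrightarrow> central (x powi k :: 'a::division_ring)"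
  by (simp add: power_int_def central_power central_inverse)

lemma central_prod_list: "(\<And>i. i \<in> set is \<Longrightarrow> central (f i)) \<Longrightarrow> central (\<Prod>i\<leftarrow>is. f i)"
  by (induction "is") (simp_all add: central_1 central_mult)

lemma inverse_powi: "inverse x powi k = x powi (- k)" for x :: "'a::division_ring"
  by (simp add: power_int_minus power_int_inverse)

lemma prod_list_cons: "(\<Prod>i\<leftarrow>[0..<Suc r]. f i) = (f 0 :: 'a::monoid_mult) * (\<Prod>i\<leftarrow>[0..<r]. f (Suc i))"
  by (simp add: upt_conv_Cons map_Suc_upt[symmetric] comp_def del: upt_Suc)

section \<open>Symmetrized quantum binomial coefficients\<close>

definition qdiff :: "'f::division_ring \<Rightarrow> int \<Rightarrow> 'f" where
  "qdiff Q n = Q powi n - Q powi (- n)"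

definition qfalling :: "'f::division_ring \<Rightarrow> int \<Rightarrow> nat \<Rightarrow> 'f" where
  "qfalling Q n r = (\<Prod>i\<leftarrow>[0..<r]. qdiff Q (n - int i))"

lemma sym_qbinomial_qfalling: "sym_qbinomial Q n r = qfalling Q n r / qfalling Q (int r) r"
  by (simp add: sym_qbinomial_def qfalling_def qdiff_def)

lemma qfalling_snoc: "qfalling Q n (Suc r) = qfalling Q n r * qdiff Q (n - int r)"
  by (simp add: qfalling_def)

lemma qfalling_cons: "qfalling Q (n + 1) (Suc r) = qdiff Q (n + 1) * qfalling Q n r"
  unfolding qfalling_def by (subst prod_list_cons) simp

lemma qfalling_eq_0: "0 \<le> n \<Longrightarrow> n < int r \<Longrightarrow> qfalling Q n r = 0"
  by (auto simp: qfalling_def qdiff_def prod_list_zero_iff image_iff intro!: bexI[of _ "nat n"])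

text \<open>
  The lower entry is an integer, with value \<open>0\<close> below \<open>0\<close>, so that the Pascal rules hold for all
  entries and index shifts need no case distinction.
\<close>

definition qbinom :: "'f::division_ring \<Rightarrow> int \<Rightarrow> int \<Rightarrow> 'f" where
  "qbinom Q n k = (if k < 0 then 0 else sym_qbinomial Q n (nat k))"

text \<open>
  Because \<open>Q\<close> is not a root of unity, the denominators of the \<open>q\<close>-binomials do not vanish. Because
  \<open>Q\<close> is central, the \<open>q\<close>-binomials behave like scalars in the skew field.
\<close>

locale generic_central =
  fixes Q :: "'f::division_ring"
  assumes central_Q: "central Q" and Q_nz: "Q \<noteq> 0" and Q_pow: "k > 0 \<Longrightarrow> Q ^ k \<noteq> 1"
begin

lemma central_qdiff: "central (qdiff Q n)"
  by (simp add: qdiff_def central_diff central_power_int central_Q)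

lemma central_qfalling: "central (qfalling Q n r)"
  by (simp add: qfalling_def central_prod_list central_qdiff)

lemma central_qbinom: "central (qbinom Q n k)"
  by (simp add: qbinom_def sym_qbinomial_qfalling divide_inverse central_0 central_mult
      central_inverse central_qfalling)

lemma qdiff_nz: "n > 0 \<Longrightarrow> qdiff Q n \<noteq> 0"
proof
  assume n: "n > 0" and "qdiff Q n = 0"
  then have "Q powi n * Q powi n = Q powi (- n) * Q powi n" by (simp add: qdiff_def)
  then have "Q powi (2 * n) = 1" using Q_nz by (simp flip: power_int_add)
  then have "Q ^ nat (2 * n) = 1" using n by (simp add: power_int_def)
  then show False using Q_pow n by simp
qed

lemma qfalling_diag_nz: "qfalling Q (int r) r \<noteq> 0"
  by (auto simp: qfalling_def prod_list_zero_iff qdiff_nz)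

lemma qbinom_diag: "n \<ge> 0 \<Longrightarrow> qbinom Q n n = 1"
  using qfalling_diag_nz[of "nat n"] by (simp add: qbinom_def sym_qbinomial_qfalling)

lemma qdiff_addition: "qdiff Q (n + 1) = Q powi (r + 1) * qdiff Q (n - r) + Q powi (r - n) * qdiff Q (r + 1)"
  by (simp add: qdiff_def right_diff_distrib Q_nz add.commute[of 1] flip: power_int_add)

text \<open>
  For \<open>k = r + 1\<close>, all three binomials are \<open>qfalling Q n r\<close>, over the denominator of
  \<open>qbinom Q n k\<close>, times one factor each; these factors are related by \<open>qdiff_addition\<close>.
\<close>

lemma qbinom_pascal: "qbinom Q (n + 1) k = Q powi k * qbinom Q n k + Q powi (k - n - 1) * qbinom Q n (k - 1)"
proof -
  consider "k < 0" | "k = 0" | r where "k = int (Suc r)"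
    by (metis int_cases not_less of_nat_less_0_iff old.nat.exhaust of_nat_0 nonneg_int_cases)
  then show ?thesis
  proof cases
    case 3
    let ?N = "qfalling Q n r" and ?D = "qfalling Q (int (Suc r)) (Suc r)"
    have D: "?D = qdiff Q (int r + 1) * qfalling Q (int r) r"
      using qfalling_cons[of Q "int r" r] by (simp add: add.commute)
    have low: "?N / qfalling Q (int r) r = qdiff Q (int r + 1) * ?N * inverse ?D"
      using qfalling_diag_nz[of r] qdiff_nz[of "int r + 1"] unfolding D divide_inverse
      by (smt (verit) mult.assoc centralD central_qdiff nonzero_inverse_mult_distrib right_inverse mult.right_neutral mult_1_left of_nat_0_le_iff)
    have "qbinom Q (n + 1) k = qdiff Q (n + 1) * (?N * inverse ?D)"
      by (simp add: qbinom_def 3 sym_qbinomial_qfalling qfalling_cons divide_inverse mult.assoc del: of_nat_Suc)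
    also have "\<dots> = Q powi k * (qdiff Q (n - int r) * (?N * inverse ?D))
       + Q powi (int r - n) * (qdiff Q (int r + 1) * (?N * inverse ?D))"
      unfolding qdiff_addition[of n "int r"] 3 by (simp add: distrib_right mult.assoc add.commute)
    also have "qdiff Q (n - int r) * (?N * inverse ?D) = qbinom Q n k"
      by (simp add: qbinom_def 3 sym_qbinomial_qfalling qfalling_snoc[of _ n] divide_inverse
          mult.assoc centralD[OF central_qdiff, of "n - int r"]  del: of_nat_Suc)
    also have "qdiff Q (int r + 1) * (?N * inverse ?D) = qbinom Q n (k - 1)"
      by (simp add: qbinom_def 3 sym_qbinomial_qfalling low mult.assoc)
    finally show ?thesis by (simp add: 3)
  qed (simp_all add: qbinom_def sym_qbinomial_0)
qed

end

lemma qdiff_inverse: "qdiff (inverse Q) n = - qdiff Q n"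
  by (simp add: qdiff_def inverse_powi)

lemma prod_list_uminus: "(\<Prod>i\<leftarrow>is. - f i) = (- 1) ^ length is * (\<Prod>i\<leftarrow>is. (f i :: 'a::ring_1))"
  by (induction "is") (simp_all add: minus_one_power_iff)

lemma qfalling_inverse: "qfalling (inverse Q) n r = (- 1) ^ r * qfalling Q n r"
  by (simp add: qfalling_def qdiff_inverse prod_list_uminus)

text \<open>
  Numerator and denominator have equally many factors, and each of them changes its sign.
\<close>

lemma sym_qbinomial_inverse: "sym_qbinomial (inverse Q) n r = sym_qbinomial Q n r"
  by (simp add: sym_qbinomial_qfalling qfalling_inverse minus_one_power_iff divide_inverse)

lemma qbinom_inverse: "qbinom (inverse Q) n k = qbinom Q n k"
  by (simp add: qbinom_def sym_qbinomial_inverse)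

lemma qbinom_eq_0: "0 \<le> n \<Longrightarrow> n < k \<Longrightarrow> qbinom Q n k = 0"
  by (simp add: qbinom_def sym_qbinomial_qfalling qfalling_eq_0)

lemma generic_central_inverse: "generic_central Q \<Longrightarrow> generic_central (inverse Q)"
proof -
  assume Q: "generic_central Q"
  have "inverse Q ^ k \<noteq> 1" if "k > 0" for k
    using generic_central.Q_pow[OF Q that] by (metis inverse_1 inverse_inverse_eq power_inverse)
  then show ?thesis using Q by (simp add: generic_central_def central_inverse)
qed

text \<open>
  The rule \<open>qbinom_pascal\<close> for \<open>Q\<^bsup>-1\<^esup>\<close>, rewritten with the symmetry of the binomials.
\<close>

lemma (in generic_central) qbinom_pascal_inverse:
  "qbinom Q (n + 1) k = Q powi (- k) * qbinom Q n k + Q powi (n + 1 - k) * qbinom Q n (k - 1)"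
proof -
  have "- (k - n - 1) = n + 1 - k" by simp
  then show ?thesis
    using generic_central.qbinom_pascal[OF generic_central_inverse[OF generic_central_axioms], of n k]
    by (simp only: qbinom_inverse inverse_powi)
qed

text \<open>
  The form of \<open>L R\<close> that fits the recurrence of the coefficients: the terms led by \<open>\<alpha>\<close> and by \<open>\<beta>\<close>
  keep the other factor unexpanded, so \<open>\<alpha> \<beta>\<close> is counted twice and must be subtracted once.
\<close>

lemma product_of_pascal_sums:
  fixes A B A' B' a b \<alpha> \<beta> :: "'a::ring_1"
  assumes "central b" "central \<beta>"
    and L: "L = a * A + \<alpha> * A'" and R: "R = b * B + \<beta> * B'"
  shows "L * R = \<alpha> * (A' * R) + \<beta> * (L * B') + (a * b) * (A * B) - (\<alpha> * \<beta>) * (A' * B')"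
  unfolding L R
  by (simp add: distrib_left distrib_right mult.assoc
      central_left_commute[OF assms(1), of A] central_left_commute[OF assms(2), of A]
      central_left_commute[OF assms(2), of A'] central_left_commute[OF assms(2), of a]
      central_left_commute[OF assms(2), of \<alpha>])

section \<open>Sums over triangles\<close>

lemma finite_triangle: "finite {(p, r). p + r \<le> (m::nat)}"
  by (rule finite_subset[of _ "{..m} \<times> {..m}"]) auto

lemma sum_triangle_shift1:
  fixes f :: "int \<Rightarrow> int \<Rightarrow> 'a::comm_monoid_add"
  assumes "\<And>r. f 0 r = 0"
  shows "(\<Sum>(p, r) \<in> {(p, r). p + r \<le> m}. f (int p + 1) (int r))
       = (\<Sum>(p, r) \<in> {(p, r). p + r \<le> Suc m}. f (int p) (int r))"
proof -
  let ?g = "\<lambda>(p, r). f (int p) (int r)" and ?s = "\<lambda>(p, r). (Suc p, r)"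
  let ?T = "\<lambda>m. {(p, r). p + r \<le> m} :: (nat \<times> nat) set"
  have "?g x = 0" if "x \<in> ?T (Suc m) - ?s ` ?T m" for x
  proof (cases x)
    case (Pair p r)
    then have "p = 0" using that by (cases p) force+
    then show ?thesis using Pair assms by simp
  qed
  then have "sum ?g (?T (Suc m)) = sum ?g (?s ` ?T m)"
    by (intro sum.mono_neutral_right finite_triangle) auto
  also have "\<dots> = (\<Sum>(p, r) \<in> ?T m. f (int p + 1) (int r))"
    by (subst sum.reindex) (auto simp: inj_on_def add.commute intro!: sum.cong)
  finally show ?thesis by simp
qed

lemma sum_triangle_swap:
  "(\<Sum>(p, r) \<in> {(p, r). p + r \<le> m}. f p r) = (\<Sum>(p, r) \<in> {(p, r). p + r \<le> (m::nat)}. f r p)"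
  by (rule sum.reindex_bij_witness[where i = prod.swap and j = prod.swap]) auto

lemma sum_triangle_shift2:
  fixes f :: "int \<Rightarrow> int \<Rightarrow> 'a::comm_monoid_add"
  assumes "\<And>p. f p 0 = 0"
  shows "(\<Sum>(p, r) \<in> {(p, r). p + r \<le> m}. f (int p) (int r + 1))
       = (\<Sum>(p, r) \<in> {(p, r). p + r \<le> Suc m}. f (int p) (int r))"
  using sum_triangle_shift1[of "\<lambda>r p. f p r" m] assms
  by (subst (1 2) sum_triangle_swap) simp

section \<open>The coefficients of the expansion\<close>

definition kronecker_coeff :: "'f::division_ring \<Rightarrow> int \<Rightarrow> int \<Rightarrow> int \<Rightarrow> 'f" where
  "kronecker_coeff Q m p r = qbinom Q (m - 1 - r) p * qbinom Q (m - p) r"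

lemma kronecker_coeff_neg: "p < 0 \<or> r < 0 \<Longrightarrow> kronecker_coeff Q m p r = 0"
  by (auto simp: kronecker_coeff_def qbinom_def)

text \<open>
  On the diagonal \<open>p + r = m\<close> only \<open>p = 0\<close> survives; it provides the monomial that is written
  separately in the closed formula.
\<close>

lemma kronecker_coeff_antidiagonal:
  assumes "p > 0" "p + r = m"
  shows "kronecker_coeff Q m p r = 0"
  using assms by (simp add: kronecker_coeff_def qbinom_eq_0)

text \<open>
  On the first diagonal outside the triangle \<open>p + r \<le> m\<close> the formula still gives \<open>0\<close>, so the triangle
  may be enlarged by this diagonal. For \<open>m = 0\<close> this fails at \<open>(p, r) = (1, 0)\<close>, where the top of the
  first binomial is \<open>-1\<close>.
\<close>

lemma kronecker_coeff_above:
  assumes "p \<ge> 0" "r \<ge> 0" "p + r = m + 1" "m > 0"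
  shows "kronecker_coeff Q m p r = 0"
proof (cases "p \<ge> 2")
  case True
  then show ?thesis using assms by (simp add: kronecker_coeff_def qbinom_eq_0)
next
  case False
  then have "m - p \<ge> 0" "m - p < r" using assms by auto
  then show ?thesis by (simp add: kronecker_coeff_def qbinom_eq_0)
qed

text \<open>
  Expand the first binomial on the left by \<open>qbinom_pascal\<close> and the second one by
  \<open>qbinom_pascal_inverse\<close>. The mixed choice of the two rules makes all powers of \<open>Q\<close> match: the
  product of the two weights \<open>Q\<^bsup>p+r-m-1\<^esup>\<close> and \<open>Q\<^bsup>m+2-p-r\<^esup>\<close> is the constant \<open>Q\<close> of the recurrence.
\<close>

lemma (in generic_central) kronecker_coeff_rec:
  "kronecker_coeff Q (m + 2) p r = Q powi (p + r - m - 1) * kronecker_coeff Q (m + 1) (p - 1) r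
     + Q powi (m + 2 - p - r) * kronecker_coeff Q (m + 1) p (r - 1)
     + Q powi (p - r) * kronecker_coeff Q (m + 1) p r
     - Q * kronecker_coeff Q m (p - 1) (r - 1)"
proof -
  have L: "qbinom Q (m + 1 - r) p = Q powi p * qbinom Q (m - r) p
      + Q powi (p + r - m - 1) * qbinom Q (m - r) (p - 1)"
    using qbinom_pascal[of "m - r" p] by (simp add: algebra_simps)
  have R: "qbinom Q (m + 2 - p) r = Q powi (- r) * qbinom Q (m + 1 - p) r
      + Q powi (m + 2 - p - r) * qbinom Q (m + 1 - p) (r - 1)"
    using qbinom_pascal_inverse[of "m + 1 - p" r] by (simp add: algebra_simps)
  have powers: "Q powi (p + r - m - 1) * Q powi (m + 2 - p - r) = Q" "Q powi p * Q powi (- r) = Q powi (p - r)"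
    by (simp_all add: Q_nz flip: power_int_add)
  have tops: "m + 2 - 1 - r = m + 1 - r" "m + 1 - 1 - r = m - r" "m + 1 - (p - 1) = m + 2 - p"
    "m - 1 - (r - 1) = m - r" "m - (p - 1) = m + 1 - p" "m + 1 - 1 - (r - 1) = m + 1 - r"
    by simp_all
  have central: "central (Q powi k)" for k
    by (simp add: central_power_int central_Q)
  show ?thesis
    unfolding kronecker_coeff_def tops
    by (rule product_of_pascal_sums[OF central central L R, unfolded powers])
qed

section \<open>The expansion as a solution of a linear recurrence\<close>

text \<open>
  The multiplication rule of the normalized monomials \<open>X\<^bsup>(a,b)\<^esup>\<close>, with \<open>h\<close> in the role of \<open>q\<^bsup>1/2\<^esup>\<close>.
  In this form the rule is preserved when \<open>h\<close> is inverted and the two coordinates are exchanged.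
\<close>

locale quantum_torus_basis =
  fixes h :: "'f::division_ring" and M :: "int \<Rightarrow> int \<Rightarrow> 'f"
  assumes central_h: "central h" and h_nz: "h \<noteq> 0" and h_pow: "k > 0 \<Longrightarrow> h ^ k \<noteq> 1"
    and M_mult: "M a b * M c d = h powi (a * d - b * c) * M (a + c) (b + d)"
begin

sublocale generic_central "h ^ 2"
  by unfold_locales (use h_pow in \<open>auto simp: central_power central_h h_nz simp flip: power_mult\<close>)

text \<open>
  At \<open>q = 1\<close> this is \<open>(X\<^sub>1\<^sup>2 + X\<^sub>2\<^sup>2 + 1) / (X\<^sub>1 X\<^sub>2)\<close>, the element attached to the minimal imaginary
  root of the Kronecker quiver, which is conserved along the exchange recursion.
\<close>

definition delta :: 'f where
  "delta = M 1 (- 1) + M (- 1) 1 + M (- 1) (- 1)"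

definition expansion :: "nat \<Rightarrow> 'f" where
  "expansion m = (\<Sum>(p, r) \<in> {(p, r). p + r \<le> m}.
     kronecker_coeff (h ^ 2) (int m) (int p) (int r) * M (2 * int p - int m) (2 * int r - int m + 1))"

lemma expansion_0: "expansion 0 = M 0 1"
proof -
  have "{(p, r). p + r \<le> (0::nat)} = {(0, 0)}" by auto
  then show ?thesis by (simp add: expansion_def kronecker_coeff_def qbinom_def sym_qbinomial_0)
qed

lemma expansion_1: "expansion 1 = M (- 1) 0 + M (- 1) 2"
proof -
  have "{(p, r). p + r \<le> (1::nat)} = {(0, 0), (0, 1), (1, 0)}" by auto
  then show ?thesis
    by (simp add: expansion_def kronecker_coeff_def qbinom_eq_0 qbinom_diag) (simp add: qbinom_def sym_qbinomial_0)
qed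

lemma central_kronecker_coeff: "central (kronecker_coeff (h ^ 2) m p r)"
  by (simp add: kronecker_coeff_def central_mult central_qbinom)

lemma h_M_mult:
  assumes c: "central c" and e: "1 + a * v - b * u = 2 * e"
  shows "h * M a b * (c * M u v) = ((h ^ 2) powi e * c) * M (a + u) (b + v)"
proof -
  have "h * M a b * (c * M u v) = c * (h * (M a b * M u v))"
    by (simp add: central_left_commute[OF c] mult.assoc)
  also have "\<dots> = c * ((h * h powi (a * v - b * u)) * M (a + u) (b + v))"
    by (simp add: M_mult mult.assoc)
  also have "h * h powi (a * v - b * u) = h powi (1 + a * v - b * u)"
    using power_int_add[of h 1 "a * v - b * u"] h_nz by (simp add: add_diff_eq)
  finally show ?thesis
    by (simp only: e power_int_power mult.assoc central_left_commute[OF c] of_nat_numeral)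
qed

text \<open>
  All four products are rewritten as sums over the same triangle \<open>p + r \<le> m + 2\<close>, indexed by the
  exponent of the resulting monomial. Then the summands agree by \<open>kronecker_coeff_rec\<close>.
\<close>

lemma expansion_rec:
  "expansion (m + 2) = h * delta * expansion (m + 1) - h ^ 2 * expansion m"
proof -
  let ?T = "\<lambda>m. {(p, r). p + r \<le> m} :: (nat \<times> nat) set"
  let ?k = "kronecker_coeff (h ^ 2)"
  let ?M = "\<lambda>p r. M (2 * p - (int m + 2)) (2 * r - (int m + 2) + 1)"
  let ?a = "\<lambda>p r. ((h ^ 2) powi (p + r - int m - 1) * ?k (int m + 1) (p - 1) r) * ?M p r"
  let ?b = "\<lambda>p r. ((h ^ 2) powi (int m + 2 - p - r) * ?k (int m + 1) p (r - 1)) * ?M p r"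
  let ?c = "\<lambda>p r. ((h ^ 2) powi (p - r) * ?k (int m + 1) p r) * ?M p r"
  let ?d = "\<lambda>p r. (h ^ 2 * ?k (int m) (p - 1) (r - 1)) * ?M p r"
  have "h * M 1 (- 1) * expansion (m + 1) = (\<Sum>(p, r) \<in> ?T (m + 1). ?a (int p + 1) (int r))"
    unfolding expansion_def sum_distrib_left split_def
    by (intro sum.cong refl, subst h_M_mult[OF central_kronecker_coeff, of _ _ _ _ "int (fst x) + int (snd x) - int m" for x])
       (auto simp: algebra_simps)
  also have "\<dots> = (\<Sum>(p, r) \<in> ?T (m + 2). ?a (int p) (int r))"
    by (subst sum_triangle_shift1[where f = ?a]) (simp_all add: kronecker_coeff_neg)
  finally have a: "h * M 1 (- 1) * expansion (m + 1) = \<dots>" .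
  have "h * M (- 1) 1 * expansion (m + 1) = (\<Sum>(p, r) \<in> ?T (m + 1). ?b (int p) (int r + 1))"
    unfolding expansion_def sum_distrib_left split_def
    by (intro sum.cong refl, subst h_M_mult[OF central_kronecker_coeff, of _ _ _ _ "int m + 1 - int (fst x) - int (snd x)" for x])
       (auto simp: algebra_simps)
  also have "\<dots> = (\<Sum>(p, r) \<in> ?T (m + 2). ?b (int p) (int r))"
    by (subst sum_triangle_shift2[where f = ?b]) (simp_all add: kronecker_coeff_neg)
  finally have b: "h * M (- 1) 1 * expansion (m + 1) = \<dots>" .
  have "h * M (- 1) (- 1) * expansion (m + 1) = (\<Sum>(p, r) \<in> ?T (m + 1). ?c (int p) (int r))"
    unfolding expansion_def sum_distrib_left split_def
    by (intro sum.cong refl, subst h_M_mult[OF central_kronecker_coeff, of _ _ _ _ "int (fst x) - int (snd x)" for x])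
       (auto simp: algebra_simps)
  also have "\<dots> = (\<Sum>(p, r) \<in> ?T (m + 2). ?c (int p) (int r))"
  proof (rule sum.mono_neutral_left)
    show "\<forall>x \<in> ?T (m + 2) - ?T (m + 1). (case x of (p, r) \<Rightarrow> ?c (int p) (int r)) = 0"
    proof
      fix x assume x: "x \<in> ?T (m + 2) - ?T (m + 1)"
      obtain p r where pr: "x = (p, r)" by fastforce
      have "int p + int r = (int m + 1) + 1" using x pr by auto
      then show "(case x of (p, r) \<Rightarrow> ?c (int p) (int r)) = 0"
        by (simp add: pr kronecker_coeff_above)
    qed
  qed (auto intro: finite_triangle)
  finally have c: "h * M (- 1) (- 1) * expansion (m + 1) = \<dots>" .
  have "h ^ 2 * expansion m = (\<Sum>(p, r) \<in> ?T m. ?d (int p + 1) (int r + 1))"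
    unfolding expansion_def sum_distrib_left split_def
    by (intro sum.cong refl) (simp add: algebra_simps)
  also have "\<dots> = (\<Sum>(p, r) \<in> ?T (m + 1). ?d (int p) (int r + 1))"
    by (subst sum_triangle_shift1[where f = "\<lambda>p r. ?d p (r + 1)"]) (simp_all add: kronecker_coeff_neg)
  also have "\<dots> = (\<Sum>(p, r) \<in> ?T (m + 2). ?d (int p) (int r))"
    by (subst sum_triangle_shift2[where f = ?d]) (simp_all add: kronecker_coeff_neg)
  finally have d: "h ^ 2 * expansion m = \<dots>" .
  have "h * delta * expansion (m + 1) - h ^ 2 * expansion m =
    (\<Sum>(p, r) \<in> ?T (m + 2). ?a (int p) (int r) + ?b (int p) (int r) + ?c (int p) (int r) - ?d (int p) (int r))"
    unfolding delta_def distrib_left distrib_right a b c d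
    by (simp add: split_def sum.distrib sum_subtractf)
  also have "\<dots> = expansion (m + 2)"
    unfolding expansion_def using kronecker_coeff_rec[of "int m"]
    by (intro sum.cong refl) (simp add: split_def add.commute[of 2 "int m"] flip: distrib_right left_diff_distrib)
  finally show ?thesis by simp
qed

lemma expansion_unique:
  assumes "x 0 = M 0 1" "x 1 = M (- 1) 0 + M (- 1) 2"
    and "\<And>m. x (m + 2) = h * delta * x (m + 1) - h ^ 2 * x m"
  shows "x m = expansion m"
proof (induction m rule: induct_nat_012)
  case (ge2 m)
  then show ?case using assms(3)[of m] expansion_rec[of m] by simp
qed (use assms(1,2) expansion_0 expansion_1 in simp_all)

lemma expansion_split:
  "expansion (n + 1) = M (- int n - 1) (int n + 2) + (\<Sum>(p, r) \<in> {(p, r). p + r \<le> n}.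
      sym_qbinomial (h ^ 2) (int n - int r) p * sym_qbinomial (h ^ 2) (int n + 1 - int p) r
      * M (2 * int p - int n - 1) (2 * int r - int n))"
proof -
  let ?T = "\<lambda>m. {(p, r). p + r \<le> m} :: (nat \<times> nat) set"
  let ?f = "\<lambda>(p, r). kronecker_coeff (h ^ 2) (int (n + 1)) (int p) (int r)
     * M (2 * int p - int (n + 1)) (2 * int r - int (n + 1) + 1)"
  have "expansion (n + 1) = sum ?f (insert (0, n + 1) (?T n))"
    unfolding expansion_def
    by (rule sum.mono_neutral_right[OF finite_triangle]) (auto intro!: kronecker_coeff_antidiagonal)
  also have "\<dots> = ?f (0, n + 1) + sum ?f (?T n)"
    by (rule sum.insert) (auto intro: finite_triangle)
  also have "?f (0, n + 1) = M (- int n - 1) (int n + 2)"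
    using qbinom_diag[of "int n + 1"]
    by (simp add: kronecker_coeff_def add.commute[of _ "int n"] diff_diff_eq)
      (simp add: qbinom_def sym_qbinomial_0)
  finally show ?thesis
    by (simp add: kronecker_coeff_def qbinom_def algebra_simps)
qed

end

section \<open>Linearization of the exchange relations\<close>

text \<open>
  Here \<open>W, A, B, Y\<close> are four consecutive cluster variables, and the claim is that \<open>Z\<close> satisfies the
  linear recurrence at \<open>A\<close> iff it does at \<open>B\<close>. Multiplied on the right by \<open>B\<close>, respectively by \<open>Q A\<close>,
  both recurrences become \<open>Q Z B A = Q\<^sup>2 A\<^sup>2 + Q + B\<^sup>2\<close>.
\<close>

lemma exchange_transports_recurrence:
  fixes A B W Y Z Q :: "'f::division_ring"
  assumes AB: "A * B = Q * (B * A)" and W: "W * B = Q * A ^ 2 + 1" and Y: "A * Y = Q * B ^ 2 + 1"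
    and nz: "A \<noteq> 0" "B \<noteq> 0" "Q \<noteq> 0" and Q: "central Q"
  shows "Z * A = Q * W + B \<longleftrightarrow> Z * B = Q * A + Y"
proof -
  note lc = central_left_commute[OF Q]
  \<comment> \<open>The aim is \<open>Q Y A = B\<^sup>2 + Q\<close>; it is compared after multiplying by \<open>A\<close>, since \<open>A Y\<close> is known.\<close>
  have "A * (Q * (Y * A)) = Q * ((A * Y) * A)" by (simp add: lc mult.assoc)
  also have "\<dots> = Q * (Q * (B * (B * A))) + Q * A" by (simp add: Y power2_eq_square distrib_right distrib_left mult.assoc)
  also have "Q * (Q * (B * (B * A))) = A * (B * B)"
    by (metis AB lc mult.assoc)
  also have "A * (B * B) + Q * A = A * (B ^ 2 + Q)"
    by (simp add: power2_eq_square distrib_left centralD[OF Q])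
  finally have YA: "Q * (Y * A) = B ^ 2 + Q" using nz by simp
  have "Z * A = Q * W + B \<longleftrightarrow> Z * A * B = (Q * W + B) * B" using nz by simp
  also have "\<dots> \<longleftrightarrow> Q * (Z * B * A) = Q * (W * B) + B ^ 2"
    by (simp add: mult.assoc AB lc distrib_right power2_eq_square)
  also have "Q * (W * B) + B ^ 2 = Q * ((Q * A + Y) * A)"
    by (simp add: W YA distrib_right distrib_left mult.assoc power2_eq_square)
  also have "Q * (Z * B * A) = Q * ((Q * A + Y) * A) \<longleftrightarrow> Z * B = Q * A + Y"
    using nz by simp
  finally show ?thesis .
qed

section \<open>Monomials of the quantum torus in its skew field of fractions\<close>

context
  fixes \<iota> :: "qtorus \<Rightarrow> 'f::division_ring"
  assumes \<iota>: "skew_fraction_field \<iota>"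
begin

lemma emb_single_mult:
  "\<iota> (Poly_Mapping.single x 1) * \<iota> (Poly_Mapping.single y 1) = \<iota> (Poly_Mapping.single (x + y) 1)"
  by (simp add: mult_single flip: emb_mult[OF \<iota>])

text \<open>
  Integer powers taken in the skew field agree with those in the group of monomials: \<open>g\<close> is a
  one-parameter subgroup of the latter.
\<close>

lemma emb_single_powi:
  assumes g: "\<And>i j. g (i + j) = g i + g j"
  shows "\<iota> (Poly_Mapping.single (g 1) 1) powi k = \<iota> (Poly_Mapping.single (g k) 1)"
proof -
  let ?e = "\<lambda>x. \<iota> (Poly_Mapping.single x 1)"
  have g0: "g 0 = 0" using g[of 0 0] by (metis add.right_neutral add_left_cancel)
  have nat: "?e (g 1) ^ n = ?e (g (int n))" for n
    by (induction n) (simp_all add: g0 emb_one[OF \<iota>] emb_single_mult g)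
  have neg: "inverse (?e (g i)) = ?e (g (- i))" for i
    by (rule inverse_unique) (simp add: emb_single_mult emb_one[OF \<iota>] g0 flip: g)
  show ?thesis
    by (cases k rule: int_cases2) (simp_all add: nat neg power_int_minus)
qed

lemma qhalf_powi: "\<iota> qhalf powi k = \<iota> (Poly_Mapping.single (QMono k 0 0) 1)"
  unfolding qhalf_def by (rule emb_single_powi[where g = "\<lambda>k. QMono k 0 0"]) simp

lemma torus_monomial_single:
  "torus_monomial \<iota> a b = \<iota> (Poly_Mapping.single (QMono (- (a * b)) a b) 1)"
proof -
  have "\<iota> torus_X1 powi k = \<iota> (Poly_Mapping.single (QMono 0 k 0) 1)" for k
    unfolding torus_X1_def by (rule emb_single_powi[where g = "\<lambda>k. QMono 0 k 0"]) simp
  moreover have "\<iota> torus_X2 powi k = \<iota> (Poly_Mapping.single (QMono 0 0 k) 1)" for k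
    unfolding torus_X2_def by (rule emb_single_powi[where g = "\<lambda>k. QMono 0 0 k"]) simp
  ultimately show ?thesis by (simp add: torus_monomial_def qhalf_powi emb_single_mult)
qed

lemma torus_monomial_mult:
  "torus_monomial \<iota> a b * torus_monomial \<iota> c d =
     \<iota> qhalf powi (a * d - b * c) * torus_monomial \<iota> (a + c) (b + d)"
  by (simp add: torus_monomial_single qhalf_powi emb_single_mult algebra_simps)

lemma qhalf_nonzero: "\<iota> qhalf \<noteq> 0"
  by (simp add: emb_eq_0_iff[OF \<iota>] qhalf_def)

lemma qvar_eq: "\<iota> qvar = \<iota> qhalf ^ 2"
  by (simp add: qvar_def emb_power[OF \<iota>])

lemma torus_monomials_basis: "quantum_torus_basis (\<iota> qhalf) (torus_monomial \<iota>)"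
proof
  show "central (\<iota> qhalf)" by (simp add: central_def qhalf_central[OF \<iota>])
  fix k :: nat assume "k > 0"
  then have "(\<iota> qhalf ^ k) ^ 2 \<noteq> 1"
    using qvar_power_neq_1[OF \<iota>, of k] by (metis qvar_eq power_mult mult.commute)
  then show "\<iota> qhalf ^ k \<noteq> 1" by auto
qed (auto simp: qhalf_nonzero torus_monomial_mult)

lemma torus_monomials_swapped_basis:
  "quantum_torus_basis (inverse (\<iota> qhalf)) (\<lambda>a b. torus_monomial \<iota> b a)"
proof -
  interpret quantum_torus_basis "\<iota> qhalf" "torus_monomial \<iota>" by (rule torus_monomials_basis)
  show ?thesis
  proof
    show "inverse (\<iota> qhalf) ^ k \<noteq> 1" if "k > 0" for k
      using h_pow[OF that] by (metis inverse_1 inverse_inverse_eq power_inverse)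
    show "torus_monomial \<iota> b a * torus_monomial \<iota> d c =
        inverse (\<iota> qhalf) powi (a * d - b * c) * torus_monomial \<iota> (b + d) (a + c)" for a b c d
      by (simp add: M_mult inverse_powi)
  qed (auto simp: central_inverse central_h h_nz)
qed

section \<open>Cluster variables of the Kronecker type\<close>

abbreviation (input) X :: "int \<Rightarrow> 'f" where "X \<equiv> cluster_var \<iota> 2 2"

lemma kronecker_exchange: "X (m - 1) * X (m + 1) = \<iota> qvar * X m ^ 2 + 1"
  using exchange_relation[OF \<iota>, of 2 2 m] by (simp add: exch_exponent_def qvar_eq)

lemma cluster_initial: "X 1 = torus_monomial \<iota> 1 0" "X 2 = torus_monomial \<iota> 0 1"
  by (simp_all add: cluster_var.simps torus_monomial_def)

interpretation quantum_torus_basis "\<iota> qhalf" "torus_monomial \<iota>" by (rule torus_monomials_basis)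

lemma monomial_0: "torus_monomial \<iota> 0 0 = 1"
  by (simp add: torus_monomial_def)

lemma cluster_0: "X 0 = torus_monomial \<iota> 2 (- 1) + torus_monomial \<iota> 0 (- 1)"
proof -
  have "X 0 * X 2 = (torus_monomial \<iota> 2 (- 1) + torus_monomial \<iota> 0 (- 1)) * X 2"
    using kronecker_exchange[of 1]
    by (simp add: cluster_initial qvar_eq power2_eq_square[of "torus_monomial \<iota> 1 0"] distrib_right M_mult monomial_0)
  then show ?thesis using cluster_var_nonzero[OF \<iota>, of 2 2 2] by simp
qed

lemma cluster_3: "X 3 = torus_monomial \<iota> (- 1) 0 + torus_monomial \<iota> (- 1) 2"
proof -
  have "X 1 * X 3 = X 1 * (torus_monomial \<iota> (- 1) 0 + torus_monomial \<iota> (- 1) 2)"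
    using kronecker_exchange[of 2]
    by (simp add: cluster_initial qvar_eq power2_eq_square[of "torus_monomial \<iota> 0 1"] distrib_left M_mult monomial_0)
  then show ?thesis using cluster_var_nonzero[OF \<iota>, of 2 2 1] by simp
qed

lemma cluster_linear_recurrence: "\<iota> qhalf * delta * X m = \<iota> qvar * X (m - 1) + X (m + 1)"
proof -
  have shift: "\<iota> qhalf * delta * X m = \<iota> qvar * X (m - 1) + X (m + 1) \<longleftrightarrow>
      \<iota> qhalf * delta * X (m + 1) = \<iota> qvar * X m + X (m + 2)" for m
  proof (rule exchange_transports_recurrence)
    show "X m * X (m + 1) = \<iota> qvar * (X (m + 1) * X m)"
      using cluster_vars_qcommute[OF \<iota>, of 2 2 m] by simp
    show "X (m - 1) * X (m + 1) = \<iota> qvar * X m ^ 2 + 1"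
      by (rule kronecker_exchange)
    show "X m * X (m + 2) = \<iota> qvar * X (m + 1) ^ 2 + 1"
      using kronecker_exchange[of "m + 1"] by (simp add: add.commute)
  qed (simp_all add: cluster_var_nonzero[OF \<iota>] qvar_eq h_nz central_Q)
  show ?thesis
  proof (induction m rule: int_induct[where k = 1])
    case base
    have "\<iota> qhalf * \<iota> qhalf powi (- 1) = 1" using h_nz by (simp add: power_int_minus)
    then show ?case
      by (simp add: cluster_initial cluster_0 delta_def distrib_left distrib_right mult.assoc M_mult)
         (simp add: qvar_eq power2_eq_square mult.assoc flip: mult.assoc[of _ "inverse _"])
  next
    case (step1 m)
    then show ?case using shift[of m] by (simp add: add.commute)
  next
    case (step2 m)
    then show ?case using shift[of "m - 1"] by (simp add: add.commute)
  qed
qed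

text \<open>
  The index starts at \<open>X\<^sub>2 = X\<^bsup>(0,1)\<^esup>\<close>, so that the coefficients for \<open>X\<^bsub>n+3\<^esub>\<close> occur at \<open>m = n + 1\<close>.
\<close>

lemma cluster_up: "X (int m + 2) = expansion m"
proof (rule expansion_unique[where x = "\<lambda>m. X (int m + 2)"])
  fix m
  show "X (int (m + 2) + 2) = \<iota> qhalf * delta * X (int (m + 1) + 2) - \<iota> qhalf ^ 2 * X (int m + 2)"
    using cluster_linear_recurrence[of "int m + 3"] by (simp add: qvar_eq add.commute)
qed (simp_all add: cluster_initial cluster_3)

interpretation swapped: quantum_torus_basis "inverse (\<iota> qhalf)" "\<lambda>a b. torus_monomial \<iota> b a"
  by (rule torus_monomials_swapped_basis)

text \<open>
  Solved for \<open>X\<^bsub>m-1\<^esub>\<close>, the linear recurrence is the one of the expansion with \<open>h\<^bsup>-1\<^esup>\<close> in place of \<open>h\<close>.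
  The element \<open>\<delta>\<close> is symmetric in the two coordinates, and \<open>X\<^sub>1 = X\<^bsup>(1,0)\<^esup>\<close> is the swapped first value.
\<close>

lemma cluster_down: "X (1 - int m) = swapped.expansion m"
proof (rule swapped.expansion_unique[where x = "\<lambda>m. X (1 - int m)"])
  fix m
  let ?h = "\<iota> qhalf"
  have "swapped.delta = delta" by (simp add: swapped.delta_def delta_def add.commute)
  then have "inverse ?h * swapped.delta * X (- int m) = inverse (?h ^ 2) * (?h * delta * X (- int m))"
    using h_nz by (simp add: power2_eq_square nonzero_inverse_mult_distrib mult.assoc)
       (simp flip: mult.assoc)
  also have "\<dots> = inverse (?h ^ 2) * (?h ^ 2 * X (- int m - 1) + X (1 - int m))"
    using cluster_linear_recurrence[of "- int m"] by (simp add: qvar_eq)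
  also have "\<dots> = X (- int m - 1) + inverse ?h ^ 2 * X (1 - int m)"
    using h_nz by (simp add: distrib_left power_inverse flip: mult.assoc)
  finally have "X (- int m - 1) = inverse ?h * swapped.delta * X (- int m) - inverse ?h ^ 2 * X (1 - int m)"
    by simp
  moreover have "1 - int (m + 2) = - int m - 1" "1 - int (m + 1) = - int m" by simp_all
  ultimately show "X (1 - int (m + 2)) = inverse ?h * swapped.delta * X (1 - int (m + 1)) - inverse ?h ^ 2 * X (1 - int m)"
    by (simp only:)
qed (simp_all add: cluster_initial cluster_0 add.commute)

lemma cluster_variable_formulas:
  "X (- int n) =
     torus_monomial \<iota> (int n + 2) (- int n - 1)
     + (\<Sum>(p, r) \<in> {(p, r). p + r \<le> n}.
          sym_qbinomial (\<iota> qvar) (int n - int r) p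
          * sym_qbinomial (\<iota> qvar) (int n + 1 - int p) r
          * torus_monomial \<iota> (2 * int r - int n) (2 * int p - int n - 1))"
  "X (int n + 3) =
     torus_monomial \<iota> (- int n - 1) (int n + 2)
     + (\<Sum>(p, r) \<in> {(p, r). p + r \<le> n}.
          sym_qbinomial (\<iota> qvar) (int n - int r) p
          * sym_qbinomial (\<iota> qvar) (int n + 1 - int p) r
          * torus_monomial \<iota> (2 * int p - int n - 1) (2 * int r - int n))"
  using cluster_down[of "n + 1"] cluster_up[of "n + 1"]
  unfolding expansion_split swapped.expansion_split power_inverse sym_qbinomial_inverse qvar_eq[symmetric]
  by (simp_all add: algebra_simps)

end

theorem proposition1p1:
  fixes \<iota> :: "qtorus \<Rightarrow> 'f::division_ring" and n :: nat
  assumes "skew_fraction_field \<iota>"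
  shows "cluster_var \<iota> 2 2 (- int n) =
           torus_monomial \<iota> (int n + 2) (- int n - 1)
           + (\<Sum>(p, r) \<in> {(p, r). p + r \<le> n}.
                sym_qbinomial (\<iota> qvar) (int n - int r) p
                * sym_qbinomial (\<iota> qvar) (int n + 1 - int p) r
                * torus_monomial \<iota> (2 * int r - int n) (2 * int p - int n - 1))
         \<and>
         cluster_var \<iota> 2 2 (int n + 3) =
           torus_monomial \<iota> (- int n - 1) (int n + 2)
           + (\<Sum>(p, r) \<in> {(p, r). p + r \<le> n}.
                sym_qbinomial (\<iota> qvar) (int n - int r) p
                * sym_qbinomial (\<iota> qvar) (int n + 1 - int p) r
                * torus_monomial \<iota> (2 * int p - int n - 1) (2 * int r - int n))"
  using cluster_variable_formulas[OF assms, of n] by blast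

end
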